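(* Let $\pi$ be a feasible packing of the rectangles $R_1,\ldots,R_n$ into the rectangle $\mathcal R$ of length $w$ and height $H$, with lowest left corners $(x_i,y_i)$, such that $y_i \bmod h_i=0$ (i.e. $y_i$ is an integer multiple of $h_i$) for every $i$. For every $i\in\{1,\ldots,n\}$ put $$u_i^\pi=x_i,\qquad v_i^\pi=\mathrm{flip}\!\left(\frac{y_i}{h_i},\,n_i,\,\mathrm{Bf}(b,n_i)\right).$$ Then the starting times $s_i=u_i^\pi+v_i^\pi w$ $(1\le i\le n)$ define a feasible periodic schedule of the jobs $J_1,\ldots,J_n$ on one machine.
   Context: Jobs and periods. Let $w>0$ be a real number, $r\ge 1$, and let $b=(b_1,\ldots,b_r)$ be a vector of positive integers. Put $B_0=1$, $B_k=b_1 b_2\cdots b_k$ and $T_k=B_k w$ for $k=1,\ldots,r$ (so $T_1=b_1w$ and $T_k=b_kT_{k-1}$ for $k\ge 2$), and $H=B_r$. There are $n$ jobs $J_1,\ldots,J_n$; job $J_i$ has a processing time $p_i$ with $0<p_i\le w$ and a period $T_{n_i}=B_{n_i}w$, where $n_i\in\{1,\ldots,r\}$. Put $h_i=wH/T_{n_i}=H/B_{n_i}$, a positive integer. Schedules. A periodic schedule assigns to each job $J_i$ a starting time $s_i$ with $0\le s_i<T_{n_i}$ of its first occurrence; the occurrences of $J_i$ start at the times $s_i+kT_{n_i}$, $k\ge 0$, and each lasts $p_i$. The schedule is feasible on one machine if for any two distinct jobs $J_i,J_j$ and all integers $0\le k<h_i$, $0\le k'<h_j$, one has $s_i+kT_{n_i}+p_i\le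 s_j+k'T_{n_j}$ or $s_j+k'T_{n_j}+p_j\le s_i+kT_{n_i}$. Flip. For a vector $c=(c_1,\ldots,c_r)$ of positive integers and $1\le k\le r$, let $\mathrm{Bf}(c,k)=(c_k,c_{k-1},\ldots,c_1,c_{k+1},\ldots,c_r)$. If $c_1\cdots c_r=H$, every integer $0\le y<H$ has a unique mixed radix decomposition $y=y_1+y_2c_1+y_3c_1c_2+\cdots+y_rc_1\cdots c_{r-1}$ with $0\le y_m<c_m$ for all $m$. For $1\le k\le r$, $\mathrm{flip}(y,k,c)$ is the integer obtained by reversing the first $k$ digits, read in the base vector $\mathrm{Bf}(c,k)$, i.e. $$\mathrm{flip}(y,k,c)=y_k+y_{k-1}c_k+y_{k-2}c_kc_{k-1}+\cdots+y_1(c_2\cdots c_k)+y_{k+1}(c_1\cdots c_k)+\cdots+y_r(c_1\cdots c_{r-1}).$$ Packing. $\mathcal R=[0,w]\times[0,H]$. For each job $J_i$, $R_i$ is a rectangle of length (horizontal side) $p_i$ and height (vertical side) $h_i$, not rotated. A packing assigns to each $R_i$ the coordinates $(x_i,y_i)$ of its lowest left corner, so that $R_i$ occupies $[x_i,x_i+p_i]\times[y_i,y_i+h_i]$. It is feasible if every $R_i$ is contained in $\mathcal R$ and no two distinct rectangles collide, where $R_i$ and $R_j$ collide if $x_i<x_j+p_j$, $x_j<x_i+p_i$, $y_i<y_j+h_j$ and $y_j<y_i+h_i$. *)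

theory Defs
  imports Complex_Main
begin

text \<open>Vectors (c_1, ..., c_r) are functions on nat of which only the values at 1, ..., r matter.
  Jobs and rectangles are indexed by 1, ..., n; the job i has the period index l i in 1, ..., r.\<close>

definition base_prod :: "(nat \<Rightarrow> nat) \<Rightarrow> nat \<Rightarrow> nat" where
  "base_prod b k = (\<Prod>j=1..k. b j)"

definition period :: "real \<Rightarrow> (nat \<Rightarrow> nat) \<Rightarrow> nat \<Rightarrow> real" where
  "period w b k = real (base_prod b k) * w"

text \<open>The division is exact for k in 1, ..., r, so this is H / B_k with H = B_r.\<close>

definition height :: "nat \<Rightarrow> (nat \<Rightarrow> nat) \<Rightarrow> nat \<Rightarrow> nat" where
  "height r b k = base_prod b r div base_prod b k"

definition feasible_schedule ::
    "real \<Rightarrow> nat \<Rightarrow> (nat \<Rightarrow> nat) \<Rightarrow> nat \<Rightarrow> (nat \<Rightarrow> real) \<Rightarrow> (nat \<Rightarrow> nat) \<Rightarrow> (nat \<Rightarrow> real) \<Rightarrow> bool" where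
  "feasible_schedule w r b n p l s \<longleftrightarrow>
    (\<forall>i\<in>{1..n}. 0 \<le> s i \<and> s i < period w b (l i)) \<and>
    (\<forall>i\<in>{1..n}. \<forall>j\<in>{1..n}. i \<noteq> j \<longrightarrow>
      (\<forall>k<height r b (l i). \<forall>k'<height r b (l j).
        s i + real k * period w b (l i) + p i \<le> s j + real k' * period w b (l j) \<or>
        s j + real k' * period w b (l j) + p j \<le> s i + real k * period w b (l i)))"

definition Bf :: "(nat \<Rightarrow> nat) \<Rightarrow> nat \<Rightarrow> nat \<Rightarrow> nat" where
  "Bf c k = (\<lambda>m. if 1 \<le> m \<and> m \<le> k then c (k + 1 - m) else c m)"

text \<open>Digits outside 1, ..., r are set to 0 so that the decomposition is unique as a function.\<close>

definition is_mixed_radix :: "nat \<Rightarrow> (nat \<Rightarrow> nat) \<Rightarrow> nat \<Rightarrow> (nat \<Rightarrow> nat) \<Rightarrow> bool" where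
  "is_mixed_radix r c y d \<longleftrightarrow>
    (\<forall>m\<in>{1..r}. d m < c m) \<and> (\<forall>m. m \<notin> {1..r} \<longrightarrow> d m = 0) \<and>
    y = (\<Sum>m=1..r. d m * base_prod c (m - 1))"

definition digits :: "nat \<Rightarrow> (nat \<Rightarrow> nat) \<Rightarrow> nat \<Rightarrow> nat \<Rightarrow> nat" where
  "digits r c y = (THE d. is_mixed_radix r c y d)"

lemma is_mixed_radix_Suc:
  "is_mixed_radix (Suc r) c y d \<longleftrightarrow>
    d (Suc r) < c (Suc r) \<and>
    (\<exists>z. is_mixed_radix r c z (d(Suc r := 0)) \<and> y = z + d (Suc r) * base_prod c r)"
proof -
  have "(\<Sum>m=1..r. (d(Suc r := 0)) m * base_prod c (m - 1)) = (\<Sum>m=1..r. d m * base_prod c (m - 1))"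
    by (rule sum.cong) auto
  then show ?thesis
    by (auto simp: is_mixed_radix_def atLeastAtMostSuc_conv Ball_def)
qed

lemma is_mixed_radix_less:
  "is_mixed_radix r c y d \<Longrightarrow> y < base_prod c r"
proof (induction r arbitrary: y d)
  case 0
  then show ?case by (simp add: is_mixed_radix_def base_prod_def)
next
  case (Suc r)
  then obtain z where z: "is_mixed_radix r c z (d(Suc r := 0))" "d (Suc r) < c (Suc r)"
    and y: "y = z + d (Suc r) * base_prod c r"
    by (auto simp: is_mixed_radix_Suc)
  have "y < Suc (d (Suc r)) * base_prod c r"
    using Suc.IH[OF z(1)] y by simp
  also have "\<dots> \<le> c (Suc r) * base_prod c r"
    using z(2) by (intro mult_right_mono) auto
  finally show ?case by (simp add: base_prod_def mult.commute)
qed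

lemma ex1_mixed_radix:
  assumes "y < base_prod c r"
  shows "\<exists>!d. is_mixed_radix r c y d"
  using assms
proof (induction r arbitrary: y)
  case 0
  then show ?case
    by (intro ex1I[of _ "\<lambda>_. 0"]) (auto simp: is_mixed_radix_def base_prod_def)
next
  case (Suc r)
  let ?P = "base_prod c r"
  have y: "y < c (Suc r) * ?P"
    using Suc.prems by (simp add: base_prod_def mult.commute)
  then have P: "0 < ?P" by (cases "?P = 0") auto
  then have "y mod ?P < ?P" by simp
  from Suc.IH[OF this] obtain d where d: "is_mixed_radix r c (y mod ?P) d"
    and uniq: "\<And>d'. is_mixed_radix r c (y mod ?P) d' \<Longrightarrow> d' = d" by blast
  have d0: "d (Suc r) = 0" using d by (simp add: is_mixed_radix_def)
  show ?case
  proof (rule ex1I[of _ "d(Suc r := y div ?P)"])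
    have "d(Suc r := 0) = d" using d0 by auto
    moreover have "y = y mod ?P + y div ?P * ?P" by (rule mod_div_mult_eq[symmetric])
    ultimately have "\<exists>z. is_mixed_radix r c z (d(Suc r := 0)) \<and> y = z + y div ?P * ?P"
      using d by metis
    then show "is_mixed_radix (Suc r) c y (d(Suc r := y div ?P))"
      using y by (simp add: is_mixed_radix_Suc less_mult_imp_div_less)
  next
    fix d' assume "is_mixed_radix (Suc r) c y d'"
    then obtain z where z: "is_mixed_radix r c z (d'(Suc r := 0))"
      and yz: "y = z + d' (Suc r) * ?P"
      by (auto simp: is_mixed_radix_Suc)
    have "z < ?P" using is_mixed_radix_less[OF z] .
    then have *: "y mod ?P = z" "y div ?P = d' (Suc r)" using yz by auto
    then have "d = d'(Suc r := 0)" using uniq z by simp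
    then show "d' = d(Suc r := y div ?P)" using * by simp
  qed
qed

text \<open>The digit m is weighted by c_(m+1) ... c_k if m is at most k, and by c_1 ... c_(m-1) otherwise.\<close>

definition flip :: "nat \<Rightarrow> nat \<Rightarrow> nat \<Rightarrow> (nat \<Rightarrow> nat) \<Rightarrow> nat" where
  "flip r y k c =
    (\<Sum>m=1..k. digits r c y m * (\<Prod>j=m+1..k. c j)) +
    (\<Sum>m=k+1..r. digits r c y m * base_prod c (m - 1))"

definition rect :: "real \<Rightarrow> real \<Rightarrow> real \<Rightarrow> real \<Rightarrow> (real \<times> real) set" where
  "rect x y p h = {x..x + p} \<times> {y..y + h}"

definition collide :: "real \<Rightarrow> real \<Rightarrow> real \<Rightarrow> real \<Rightarrow> real \<Rightarrow> real \<Rightarrow> real \<Rightarrow> real \<Rightarrow> bool" where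
  "collide x y p h x' y' p' h' \<longleftrightarrow> x < x' + p' \<and> x' < x + p \<and> y < y' + h' \<and> y' < y + h"

definition feasible_packing ::
    "real \<Rightarrow> nat \<Rightarrow> (nat \<Rightarrow> nat) \<Rightarrow> nat \<Rightarrow> (nat \<Rightarrow> real) \<Rightarrow> (nat \<Rightarrow> nat) \<Rightarrow>
      (nat \<Rightarrow> real) \<Rightarrow> (nat \<Rightarrow> real) \<Rightarrow> bool" where
  "feasible_packing w r b n p l x y \<longleftrightarrow>
    (\<forall>i\<in>{1..n}. rect (x i) (y i) (p i) (real (height r b (l i)))
        \<subseteq> rect 0 0 w (real (base_prod b r))) \<and>
    (\<forall>i\<in>{1..n}. \<forall>j\<in>{1..n}. i \<noteq> j \<longrightarrow>
      \<not> collide (x i) (y i) (p i) (real (height r b (l i)))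
          (x j) (y j) (p j) (real (height r b (l j))))"

definition start_u :: "(nat \<Rightarrow> real) \<Rightarrow> nat \<Rightarrow> real" where
  "start_u x i = x i"

text \<open>In the intended use y i is a nonnegative integer multiple of the height of rectangle i,
  so taking the integer part only converts the type.\<close>

definition start_v :: "nat \<Rightarrow> (nat \<Rightarrow> nat) \<Rightarrow> (nat \<Rightarrow> nat) \<Rightarrow> (nat \<Rightarrow> real) \<Rightarrow> nat \<Rightarrow> nat" where
  "start_v r b l y i = flip r (nat \<lfloor>y i / real (height r b (l i))\<rfloor>) (l i) (Bf b (l i))"

end

theory Submission
  imports Defs
begin

text \<open>Cut the time axis into rows \<open>[q w, (q + 1) w)\<close>. Every occurrence of a job stays inside one row,
  so only occurrences in a common row \<open>q\<close> can conflict. Let \<open>q'\<close> be the integer obtained from \<open>q\<close>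
  by reversing all \<open>r\<close> digits, read in \<open>Bf b r\<close>. The job \<open>i\<close> occurs in row \<open>q\<close> only if \<open>q\<close> is congruent to
  \<open>v\<^sub>i\<close> modulo \<open>B\<^bsub>n\<^sub>i\<^esub>\<close>, and then the leading digits of \<open>q'\<close> are those of \<open>y\<^sub>i / h\<^sub>i\<close>, that is,
  \<open>y\<^sub>i \<le> q' < y\<^sub>i + h\<^sub>i\<close>. Hence two jobs sharing a row have rectangles that overlap vertically, so these
  are disjoint horizontally, and so are the two occurrences.\<close>

section \<open>Base products and heights\<close>

lemma base_prod_0 [simp]: "base_prod b 0 = 1"
  by (simp add: base_prod_def)

lemma base_prod_Suc [simp]: "base_prod b (Suc k) = base_prod b k * b (Suc k)"
  by (simp add: base_prod_def)

lemma base_prod_pos: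
  assumes "\<forall>j\<in>{1..r}. b j > 0" and "k \<le> r"
  shows "base_prod b k > 0"
  using assms by (auto simp: base_prod_def intro!: prod_pos)

lemma base_prod_dvd: "k \<le> r \<Longrightarrow> base_prod b k dvd base_prod b r"
  unfolding base_prod_def by (rule prod_dvd_prod_subset) auto

lemma base_prod_mono:
  assumes "\<forall>j\<in>{1..r}. b j > 0" and "k \<le> r"
  shows "base_prod b k \<le> base_prod b r"
  using base_prod_dvd[OF assms(2)] base_prod_pos[OF assms(1), of r] by (auto intro: dvd_imp_le)

lemma height_mult_base_prod:
  "k \<le> r \<Longrightarrow> height r b k * base_prod b k = base_prod b r"
  by (simp add: height_def base_prod_dvd)

lemma height_pos:
  assumes "\<forall>j\<in>{1..r}. b j > 0" and "k \<le> r"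
  shows "height r b k > 0"
  using height_mult_base_prod[OF assms(2), of b] base_prod_pos[OF assms(1), of r]
  by (cases "height r b k = 0") auto

section \<open>Digit reversal as a recursion\<close>

text \<open>Reverses the \<open>k\<close> lowest base-\<open>b\<close> digits of \<open>q\<close> and reads them in the base vector \<open>Bf b k\<close>. A recursion
  on \<open>k\<close> through \<open>div\<close> and \<open>mod\<close> replaces \<open>flip\<close> here, since it is also meaningful for \<open>q \<ge> B\<^sub>k\<close>.\<close>

fun digit_reversal :: "(nat \<Rightarrow> nat) \<Rightarrow> nat \<Rightarrow> nat \<Rightarrow> nat" where
  "digit_reversal b 0 q = 0"
| "digit_reversal b (Suc k) q =
    digit_reversal b k q * b (Suc k) + q div base_prod b k mod b (Suc k)"

text \<open>Only the \<open>k\<close> lowest digits are read, and a multiple of \<open>B_k\<close>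
  leaves them unchanged. Hence all occurrences of a job share one reversal.\<close>

lemma digit_reversal_add_mult:
  assumes "\<forall>j\<in>{1..k}. b j > 0"
  shows "digit_reversal b k (q + t * base_prod b k) = digit_reversal b k q"
  using assms
proof (induction k arbitrary: t)
  case 0
  then show ?case by simp
next
  case (Suc k)
  have "base_prod b k > 0"
    using Suc.prems by (intro base_prod_pos[of "Suc k"]) auto
  \<comment> \<open>Regrouping \<open>t * B_(k+1)\<close> as \<open>(t * b_(k+1)) * B_k\<close>
    shifts the quotient by a multiple of \<open>b_(k+1)\<close>, which the final \<open>mod\<close>
    removes.\<close>
  then have "(q + (t * b (Suc k)) * base_prod b k) div base_prod b k = t * b (Suc k) + q div base_prod b k"
    by (intro div_mult_self1) simp
  then have "(q + t * base_prod b (Suc k)) div base_prod b k = q div base_prod b k + t * b (Suc k)"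
    by (simp add: mult_ac)
  moreover have "digit_reversal b k (q + t * base_prod b (Suc k)) = digit_reversal b k q"
    using Suc.IH[of "t * b (Suc k)"] Suc.prems by (simp add: mult_ac)
  ultimately show ?case by simp
qed

text \<open>Each recursion step appends a new least significant digit. Dividing by
  \<open>H / B_k = b_(k+1) ... b_r\<close> cuts off exactly the digits appended after step
  \<open>k\<close>.\<close>

lemma digit_reversal_div_height:
  assumes "\<forall>j\<in>{1..r}. b j > 0" and "k \<le> r"
  shows "digit_reversal b r q div height r b k = digit_reversal b k q"
  using assms(2,1)
proof (induction rule: dec_induct)
  case base
  then show ?case using base_prod_pos[of k b k] by (simp add: height_def)
next
  case (step r)
  then have b: "b (Suc r) > 0" by simp
  have "height (Suc r) b k = b (Suc r) * height r b k"
    using div_mult_swap[OF base_prod_dvd[OF step.hyps(1), of b], of "b (Suc r)"]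
    by (simp add: height_def mult.commute)
  then show ?case using step b by (simp add: div_mult2_eq)
qed

text \<open>Links the recursion to explicit digits. The bound is proved in the same induction
  because it lets \<open>div\<close> isolate the top digit.\<close>

lemma digit_reversal_sum:
  assumes "\<forall>j\<in>{1..k}. d j < b j"
  shows "digit_reversal b k (\<Sum>j=1..k. d j * base_prod b (j - 1)) = (\<Sum>j=1..k. d j * (\<Prod>i=j+1..k. b i))"
    and "(\<Sum>j=1..k. d j * base_prod b (j - 1)) < base_prod b k"
  using assms
proof (induction k)
  case 0
  { case 1 show ?case by simp }
  { case 2 show ?case by simp }
next
  case (Suc k)
  let ?S = "\<Sum>j=1..k. d j * base_prod b (j - 1)"
  let ?q = "?S + d (Suc k) * base_prod b k"
  have q: "(\<Sum>j=1..Suc k. d j * base_prod b (j - 1)) = ?q" by simp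
  {
    case 1
    then have d: "\<forall>j\<in>{1..k}. d j < b j" and dk: "d (Suc k) < b (Suc k)" by auto
    have "?q div base_prod b k mod b (Suc k) = d (Suc k)"
      using Suc.IH(2)[OF d] dk by simp
    moreover have "digit_reversal b k ?q = (\<Sum>j=1..k. d j * (\<Prod>i=j+1..k. b i))"
    proof -
      have "\<forall>j\<in>{1..k}. b j > 0" using d by fastforce
      then show ?thesis by (simp only: digit_reversal_add_mult Suc.IH(1)[OF d])
    qed
    ultimately show ?case
      unfolding q by (simp add: sum_distrib_right mult.assoc)
  next
    case 2
    then have d: "\<forall>j\<in>{1..k}. d j < b j" and dk: "d (Suc k) < b (Suc k)" by auto
    have "?q < Suc (d (Suc k)) * base_prod b k"
      using Suc.IH(2)[OF d] by simp
    also have "\<dots> \<le> b (Suc k) * base_prod b k"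
      using dk by (intro mult_right_mono) auto
    finally show ?case unfolding q by (simp add: mult.commute)
  }
qed

section \<open>Flip and digit reversal\<close>

lemma base_prod_Bf:
  assumes "m \<le> k"
  shows "base_prod (Bf b k) m = (\<Prod>i=k+1-m..k. b i)"
  unfolding base_prod_def Bf_def
  by (rule prod.reindex_bij_witness[of _ "\<lambda>i. k + 1 - i" "\<lambda>i. k + 1 - i"]) (use assms in auto)

lemma prod_Bf:
  "(\<Prod>j=m+1..k. Bf b k j) = base_prod b (k - m)"
  unfolding base_prod_def Bf_def
  by (rule prod.reindex_bij_witness[of _ "\<lambda>i. k + 1 - i" "\<lambda>i. k + 1 - i"]) auto

text \<open>The witness \<open>d\<close> lists the digits of \<open>Y\<close> in base
  \<open>Bf b k\<close> backwards. Reversing the base as well turns the weights used by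
  \<open>flip\<close> into the ordinary weights of \<open>b\<close>.\<close>

lemma flip_Bf_digits:
  assumes pos: "\<forall>j\<in>{1..r}. b j > 0" and "k \<le> r" and Y: "Y < base_prod b k"
  obtains d where "\<forall>j\<in>{1..k}. d j < b j"
    and "flip r Y k (Bf b k) = (\<Sum>j=1..k. d j * base_prod b (j - 1))"
    and "Y = (\<Sum>j=1..k. d j * (\<Prod>i=j+1..k. b i))"
proof -
  let ?c = "Bf b k"
  define e where "e = digits r ?c Y"
  have cpos: "\<forall>j\<in>{1..r}. ?c j > 0"
    unfolding Bf_def
  proof
    fix j assume "j \<in> {1..r}"
    then have "(if 1 \<le> j \<and> j \<le> k then k + 1 - j else j) \<in> {1..r}" using \<open>k \<le> r\<close> by auto
    then show "0 < (if 1 \<le> j \<and> j \<le> k then b (k + 1 - j) else b j)"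
      using pos by (auto split: if_splits)
  qed
  have ck: "base_prod ?c k = base_prod b k"
    using base_prod_Bf[of k k b] by (simp add: base_prod_def)
  have "Y < base_prod ?c r"
    using base_prod_mono[OF cpos \<open>k \<le> r\<close>] Y ck by simp
  from theI'[OF ex1_mixed_radix[OF this]] have "is_mixed_radix r ?c Y e"
    unfolding e_def digits_def .
  then have e: "\<forall>m\<in>{1..r}. e m < ?c m" and Ye: "Y = (\<Sum>m=1..r. e m * base_prod ?c (m - 1))"
    by (auto simp: is_mixed_radix_def)
  \<comment> \<open>A nonzero digit above position \<open>k\<close> would alone contribute at least
    \<open>B_k > Y\<close>.\<close>
  have e0: "e m = 0" if m: "m \<in> {k+1..r}" for m
  proof (rule ccontr)
    assume "e m \<noteq> 0"
    have "base_prod ?c k \<le> base_prod ?c (m - 1)"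
      using m cpos by (intro base_prod_mono) auto
    also have "\<dots> \<le> e m * base_prod ?c (m - 1)" using \<open>e m \<noteq> 0\<close> by simp
    also have "\<dots> \<le> Y" unfolding Ye
      using m by (intro member_le_sum) auto
    finally show False using Y ck by simp
  qed
  let ?d = "\<lambda>j. e (k + 1 - j)"
  have "?d j < b j" if "j \<in> {1..k}" for j
  proof -
    have "k + 1 - j \<in> {1..r}" using that \<open>k \<le> r\<close> by auto
    then have "?d j < ?c (k + 1 - j)" using e by blast
    moreover have "?c (k + 1 - j) = b j" using that by (auto simp: Bf_def)
    ultimately show ?thesis by simp
  qed
  moreover have "flip r Y k ?c = (\<Sum>j=1..k. ?d j * base_prod b (j - 1))"
  proof -
    have "flip r Y k ?c = (\<Sum>m=1..k. e m * base_prod b (k - m))"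
      unfolding flip_def e_def[symmetric] prod_Bf by (simp add: e0)
    also have "\<dots> = (\<Sum>j=1..k. ?d j * base_prod b (j - 1))"
      by (subst sum.atLeastAtMost_rev) (auto intro!: sum.cong)
    finally show ?thesis .
  qed
  moreover have "Y = (\<Sum>j=1..k. ?d j * (\<Prod>i=j+1..k. b i))"
  proof -
    have "Y = (\<Sum>m=1..k. e m * base_prod ?c (m - 1))"
      unfolding Ye using \<open>k \<le> r\<close> e0 by (intro sum.mono_neutral_right) auto
    \<comment> \<open>The weight index is \<open>m - 1\<close>, so the product starts at
      \<open>k + 1 - (m - 1)\<close>; this form suits the substitution
      \<open>j = k + 1 - m\<close>.\<close>
    also have "\<dots> = (\<Sum>m=1..k. e m * (\<Prod>i=k+1-m+1..k. b i))"
      by (intro sum.cong refl) (auto simp: base_prod_Bf Suc_diff_le)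
    also have "\<dots> = (\<Sum>j=1..k. ?d j * (\<Prod>i=j+1..k. b i))"
      by (subst sum.atLeastAtMost_rev) (auto intro!: sum.cong)
    finally show ?thesis .
  qed
  ultimately show thesis by (intro that[of ?d] ballI)
qed

lemma digit_reversal_flip:
  assumes "\<forall>j\<in>{1..r}. b j > 0" and "k \<le> r" and "Y < base_prod b k"
  shows "digit_reversal b k (flip r Y k (Bf b k)) = Y"
    and "flip r Y k (Bf b k) < base_prod b k"
proof -
  obtain d where d: "\<forall>j\<in>{1..k}. d j < b j"
    and flip: "flip r Y k (Bf b k) = (\<Sum>j=1..k. d j * base_prod b (j - 1))"
    and Y: "Y = (\<Sum>j=1..k. d j * (\<Prod>i=j+1..k. b i))"
    using flip_Bf_digits[OF assms] .
  show "digit_reversal b k (flip r Y k (Bf b k)) = Y"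
    unfolding flip digit_reversal_sum(1)[OF d] by (rule Y[symmetric])
  show "flip r Y k (Bf b k) < base_prod b k"
    unfolding flip by (rule digit_reversal_sum(2)[OF d])
qed

section \<open>From the packing to the schedule\<close>

theorem lemma5:
  fixes w :: real and r n :: nat and b l :: "nat \<Rightarrow> nat" and p x y :: "nat \<Rightarrow> real"
  assumes "w > 0" and "r \<ge> 1"
    and "\<forall>k\<in>{1..r}. b k > 0"
    and "\<forall>i\<in>{1..n}. 0 < p i \<and> p i \<le> w"
    and "\<forall>i\<in>{1..n}. l i \<in> {1..r}"
    and "feasible_packing w r b n p l x y"
    and "\<forall>i\<in>{1..n}. \<exists>z::int. y i = of_int z * real (height r b (l i))"
  shows "feasible_schedule w r b n p l (\<lambda>i. start_u x i + real (start_v r b l y i) * w)"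
proof -
  let ?h = "\<lambda>i. height r b (l i)" and ?B = "\<lambda>i. base_prod b (l i)"
  let ?v = "start_v r b l y"
  define Y where "Y i = nat \<lfloor>y i / real (?h i)\<rfloor>" for i
  have l: "l i \<le> r" if "i \<in> {1..n}" for i using assms(5) that by auto
  have x: "0 \<le> x i" "x i + p i \<le> w" and y: "y i = real (Y i * ?h i)" and YB: "Y i < ?B i"
    if i: "i \<in> {1..n}" for i
  proof -
    have h: "?h i > 0" using height_pos[OF assms(3) l[OF i]] .
    have p: "0 < p i" using assms(4) i by blast
    have sub: "rect (x i) (y i) (p i) (real (?h i)) \<subseteq> rect 0 0 w (real (base_prod b r))"
      using assms(6) i by (auto simp: feasible_packing_def)
    have "(x i, y i) \<in> rect (x i) (y i) (p i) (real (?h i))"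
      and "(x i + p i, y i + real (?h i)) \<in> rect (x i) (y i) (p i) (real (?h i))"
      using p by (auto simp: rect_def)
    then have corners: "(x i, y i) \<in> rect 0 0 w (real (base_prod b r))"
      and corners': "(x i + p i, y i + real (?h i)) \<in> rect 0 0 w (real (base_prod b r))"
      using sub by blast+
    then show "0 \<le> x i" and "x i + p i \<le> w"
      by (auto simp: rect_def)
    have y0: "0 \<le> y i" and yH: "y i + real (?h i) \<le> real (base_prod b r)"
      using corners corners' by (auto simp: rect_def)
    obtain z :: int where z: "y i = of_int z * real (?h i)" using assms(7) i by blast
    have "0 \<le> z" using y0 z h by (simp add: zero_le_mult_iff)
    moreover have "Y i = nat z" using z h by (simp add: Y_def)
    ultimately show y: "y i = real (Y i * ?h i)" using z by simp
    \<comment> \<open>The top edge lies below \<open>H = B_i * h_i\<close>, so cancelling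
      \<open>h_i\<close> leaves room for one more unit: \<open>Y i + 1 \<le> B_i\<close>.\<close>
    have "Y i * ?h i + ?h i \<le> base_prod b r"
      using yH unfolding y by (metis of_nat_add of_nat_le_iff)
    also have "\<dots> = ?B i * ?h i" using height_mult_base_prod[OF l[OF i], of b] by (simp add: mult.commute)
    finally have "Suc (Y i) * ?h i \<le> ?B i * ?h i" by simp
    then show "Y i < ?B i" using h by (simp only: mult_le_cancel2) simp
  qed
  have v: "?v i < ?B i" "digit_reversal b (l i) (?v i) = Y i" if i: "i \<in> {1..n}" for i
    using digit_reversal_flip[OF assms(3) l[OF i] YB[OF i]] by (simp_all add: start_v_def Y_def)
  \<comment> \<open>The rows of job \<open>i\<close> are \<open>v_i + k * B_i\<close>. Their full
    reversals all have quotient \<open>Y i\<close> by \<open>h_i\<close>, which is equivalent to the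
    two bounds.\<close>
  have row: "Y i * ?h i \<le> digit_reversal b r (?v i + k * ?B i)"
      "digit_reversal b r (?v i + k * ?B i) < Y i * ?h i + ?h i" if i: "i \<in> {1..n}" for i k
  proof -
    have "digit_reversal b r (?v i + k * ?B i) div ?h i = Y i"
      using digit_reversal_div_height[OF assms(3) l[OF i]] digit_reversal_add_mult[of "l i" b]
        v(2)[OF i] assms(3) l[OF i] by auto
    then show "Y i * ?h i \<le> digit_reversal b r (?v i + k * ?B i)"
      "digit_reversal b r (?v i + k * ?B i) < Y i * ?h i + ?h i"
      using height_pos[OF assms(3) l[OF i]]
      by (metis div_times_less_eq_dividend, metis dividend_less_div_times add.commute)
  qed
  have different_rows: "x i + real q * w + p i \<le> x j + real q' * w"
    if "i \<in> {1..n}" "j \<in> {1..n}" "q < q'" for i j q q'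
  proof -
    have "(real q + 1) * w \<le> real q' * w"
      using that(3) \<open>w > 0\<close> by (intro mult_right_mono) auto
    then show ?thesis using x(2)[OF that(1)] x(1)[OF that(2)] by (simp add: algebra_simps)
  qed
  have start: "start_u x i + real (?v i) * w + real k * period w b (l i)
      = x i + real (?v i + k * ?B i) * w" for i k
    by (simp add: start_u_def period_def algebra_simps)
  show ?thesis
    unfolding feasible_schedule_def start
  proof (intro conjI ballI impI allI)
    fix i assume i: "i \<in> {1..n}"
    show "0 \<le> start_u x i + real (?v i) * w"
      using x(1)[OF i] \<open>w > 0\<close> by (simp add: start_u_def)
    have "x i < w" using x(2)[OF i] assms(4) i by fastforce
    \<comment> \<open>Integrality of \<open>v_i < B_i\<close> gives a whole row of slack, which
      absorbs \<open>x i < w\<close>.\<close>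
    moreover have "(real (?v i) + 1) * w \<le> real (?B i) * w"
      using v(1)[OF i] \<open>w > 0\<close> by (intro mult_right_mono) auto
    ultimately show "start_u x i + real (?v i) * w < period w b (l i)"
      by (simp add: start_u_def period_def algebra_simps)
  next
    fix i j k k' assume i: "i \<in> {1..n}" and j: "j \<in> {1..n}" and "i \<noteq> j"
    let ?q = "?v i + k * ?B i" and ?q' = "?v j + k' * ?B j"
    consider "?q < ?q'" | "?q' < ?q" | "?q = ?q'" by linarith
    then show "x i + real ?q * w + p i \<le> x j + real ?q' * w \<or>
        x j + real ?q' * w + p j \<le> x i + real ?q * w"
    proof cases
      case 1
      then show ?thesis using different_rows[OF i j] by blast
    next
      case 2
      then show ?thesis using different_rows[OF j i] by blast
    next
      case 3
      \<comment> \<open>The reversal of the common row lies in both half-open vertical ranges, so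
        these overlap.\<close>
      have "Y i * ?h i < Y j * ?h j + ?h j" "Y j * ?h j < Y i * ?h i + ?h i"
        using row[OF i, of k, unfolded 3] row[OF j, of k'] by linarith+
      then have "y i < y j + real (?h j)" "y j < y i + real (?h i)"
        unfolding y[OF i] y[OF j] by (metis of_nat_add of_nat_less_iff)+
      moreover have "\<not> collide (x i) (y i) (p i) (real (?h i)) (x j) (y j) (p j) (real (?h j))"
        using assms(6) i j \<open>i \<noteq> j\<close> by (auto simp: feasible_packing_def)
      ultimately show ?thesis unfolding 3 by (auto simp: collide_def)
    qed
  qed
qed

end
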